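(* For every permutation $\pi$, the tier $t(\pi)$ of $\pi$ under the multi-pass stack sorting algorithm equals the number of separated pairs in $\pi$.
   Context: Permutations are sequences $\pi=\pi_1\cdots\pi_n$ of the values $1,\dots,n$. Multi-pass stack sorting: in a pass, the entries of the current input are pushed one at a time, in order, onto a stack; whenever the top of the stack is the next value needed for the output (the smallest value not yet output), it is popped to the output (repeatedly, as long as this holds). Entries are never popped otherwise. When all input entries have been pushed and no pop is possible, if the stack is nonempty the pass ends and the entries remaining in the stack are returned to the input in their original relative order (reading the stack from bottom to top), and a new pass begins. A permutation is $k$-pass sortable if this procedure outputs $1,2,\dots,n$ using at most $k$ passes. The tier $t(\pi)$ is one less than the minimum number of passes needed to sort $\pi$. For $1\le i\le n-1$, the pair $(i+1,i)$ is a separated pair of $\pi$ if $\pi$ contains a subsequence $(i+1,k,i)$ (in this order of positions) with $k>i+1$. *)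

theory Defs
  imports "HOL-Library.Sublist" "HOL-Combinatorics.Multiset_Permutations"
begin

text \<open>
  A permutation of \<open>1, \<dots>, n\<close> is the list of its entries, an element of
  \<^term>\<open>permutations_of_set {1..n::nat}\<close>. The output is a list in order of output; a stack is
  a list whose head is the top.
\<close>

definition next_value :: "nat list \<Rightarrow> nat" where
  "next_value out = (LEAST v. 1 \<le> v \<and> v \<notin> set out)"

fun pop_all :: "nat list \<Rightarrow> nat list \<Rightarrow> nat list \<times> nat list" where
  "pop_all out [] = (out, [])"
| "pop_all out (x # st) =
     (if x = next_value out then pop_all (out @ [x]) st else (out, x # st))"

text \<open>The arguments are the output so far, the stack and the input still to be pushed.\<close>

fun run_pass :: "nat list \<Rightarrow> nat list \<Rightarrow> nat list \<Rightarrow> nat list \<times> nat list" where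
  "run_pass out st [] = (out, st)"
| "run_pass out st (x # xs) =
     (let (out', st') = pop_all out (x # st) in run_pass out' st' xs)"

text \<open>
  A complete pass acts on pairs of output and input. The entries left on the stack are returned to
  the input from bottom to top, hence the reversal.
\<close>

definition sort_pass :: "nat list \<times> nat list \<Rightarrow> nat list \<times> nat list" where
  "sort_pass s = (let (out, st) = run_pass (fst s) [] (snd s) in (out, rev st))"

text \<open>
  The procedure starts with a pass whatever its input, so it always uses at least one; the
  condition \<open>1 \<le> j\<close> only matters for the empty permutation, whose tier is therefore \<open>0\<close>.
\<close>

definition k_pass_sortable :: "nat \<Rightarrow> nat list \<Rightarrow> bool" where
  "k_pass_sortable k \<pi> \<longleftrightarrow>
     (\<exists>j. 1 \<le> j \<and> j \<le> k \<and> (sort_pass ^^ j) ([], \<pi>) = ([1..<Suc (length \<pi>)], []))"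

definition tier :: "nat list \<Rightarrow> nat" where
  "tier \<pi> = (LEAST k. k_pass_sortable k \<pi>) - 1"

definition separated_pairs :: "nat list \<Rightarrow> (nat \<times> nat) set" where
  "separated_pairs \<pi> =
     {(i + 1, i) | i. 1 \<le> i \<and> i < length \<pi> \<and> (\<exists>k. k > i + 1 \<and> subseq [i + 1, k, i] \<pi>)}"

end

theory Submission imports Defs begin

text \<open>
  While the next value to be output is \<open>j\<close>, the stack holds the entries \<open>\<ge> j\<close> of the prefix read so
  far. If \<open>j\<close> is output from the top of the stack and \<open>j + 1\<close> was read before \<open>j\<close>, then \<open>j + 1\<close>
  becomes the new top unless a larger entry lies between \<open>j + 1\<close> and \<open>j\<close>, that is, unless
  \<open>(j + 1, j)\<close> is separated; in that case \<open>j + 1\<close> is stuck until the end of the pass. Hence each pass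
  but the last gets past exactly one separated pair: it outputs up to the smallest remaining \<open>i\<close> such
  that \<open>(i + 1, i)\<close> is separated.
\<close>

section \<open>Subsequences and separated pairs\<close>

definition separated :: "nat list \<Rightarrow> nat \<Rightarrow> bool" where
  "separated l i \<longleftrightarrow> (\<exists>k > i + 1. subseq [i + 1, k, i] l)"

lemma subseq_Cons_append_Cons:
  "x \<notin> set p \<Longrightarrow> subseq (x # ys) (p @ x # xs) \<longleftrightarrow> subseq ys xs"
  by (induction p) auto

lemma subseq_rev_mono: "subseq xs ys \<Longrightarrow> subseq (rev xs) (rev ys)"
  by (induction rule: list_emb.induct) (auto intro: list_emb_append2 subseq_order.order_trans)

lemma subseq_rev_iff: "subseq (rev xs) (rev ys) \<longleftrightarrow> subseq xs ys"
  using subseq_rev_mono[of xs ys] subseq_rev_mono[of "rev xs" "rev ys"] by auto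

lemma subseq_snoc_append_Cons:
  assumes "x \<notin> set t"
  shows "subseq (ys @ [x]) (s @ x # t) \<longleftrightarrow> subseq ys s"
proof -
  have "subseq (ys @ [x]) (s @ x # t) \<longleftrightarrow> subseq (rev (ys @ [x])) (rev (s @ x # t))"
    by (simp only: subseq_rev_iff)
  also have "\<dots> \<longleftrightarrow> subseq (x # rev ys) (rev t @ x # rev s)"
    by simp
  also have "\<dots> \<longleftrightarrow> subseq (rev ys) (rev s)"
    using assms by (subst subseq_Cons_append_Cons) auto
  finally show ?thesis by (simp only: subseq_rev_iff)
qed

text \<open>A witness for \<open>separated\<close> consists of entries that are all at least
  \<open>i\<close>, so dropping smaller values changes nothing. This lets the input of a later pass
  be replaced by the original permutation.\<close>

lemma separated_filter:
  assumes "m \<le> i"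
  shows "separated (filter (\<lambda>x. m \<le> x) l) i \<longleftrightarrow> separated l i"
proof
  assume "separated (filter (\<lambda>x. m \<le> x) l) i"
  then show "separated l i"
    unfolding separated_def by (meson subseq_filter_left subseq_order.order_trans)
next
  assume "separated l i"
  then obtain k where k: "k > i + 1" "subseq [i + 1, k, i] l"
    unfolding separated_def by blast
  from k(2) have "subseq (filter (\<lambda>x. m \<le> x) [i + 1, k, i]) (filter (\<lambda>x. m \<le> x) l)"
    by (rule subseq_filter)
  with k(1) assms show "separated (filter (\<lambda>x. m \<le> x) l) i"
    unfolding separated_def by auto
qed

text \<open>In \<open>pass_inv_pop\<close>, \<open>rev s\<close> is the stack below the top
  \<open>j\<close>. By distinctness every entry of \<open>s\<close> after \<open>Suc j\<close>
  exceeds \<open>j + 1\<close> and so witnesses separation; only having \<open>Suc j\<close>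
  directly before \<open>j\<close> avoids this.\<close>

lemma separated_iff_last:
  assumes "distinct l" and f: "filter (\<lambda>x. j \<le> x) l = s @ j # t" and "Suc j \<in> set s"
  shows "separated l j \<longleftrightarrow> last s \<noteq> Suc j"
proof -
  have d: "distinct (s @ j # t)"
    using assms(1) f by (metis distinct_filter)
  have ge: "j \<le> x" if "x \<in> set (s @ j # t)" for x
    using that arg_cong[OF f, of set] by auto
  obtain u v where s: "s = u @ Suc j # v"
    using assms(3) by (meson split_list)
  have "separated l j \<longleftrightarrow> separated (s @ j # t) j"
    using separated_filter[of j j l] f by simp
  also have "\<dots> \<longleftrightarrow> (\<exists>k > j + 1. subseq [Suc j, k] s)"
    using d subseq_snoc_append_Cons[of j t "[Suc j, k]" s for k] by (simp add: separated_def)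
  also have "\<dots> \<longleftrightarrow> (\<exists>k > j + 1. subseq [k] v)"
    using d unfolding s by (subst subseq_Cons_append_Cons) auto
  also have "\<dots> \<longleftrightarrow> (\<exists>k > j + 1. k \<in> set v)"
    by (simp add: subseq_singleton_left)
  also have "\<dots> \<longleftrightarrow> v \<noteq> []"
  proof
    assume "v \<noteq> []"
    then have v: "hd v \<in> set v" by simp
    then have "j \<le> hd v" "hd v \<noteq> j" "hd v \<noteq> Suc j"
      using d ge[of "hd v"] unfolding s by auto
    then show "\<exists>k > j + 1. k \<in> set v"
      using v by (intro exI[of _ "hd v"]) auto
  qed auto
  also have "\<dots> \<longleftrightarrow> last s \<noteq> Suc j"
    using d unfolding s by (cases v rule: rev_cases) auto
  finally show ?thesis .
qed

lemma not_separated_later: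
  assumes "distinct (p @ Suc i # xs)" and "i \<in> set p"
  shows "\<not> separated (p @ Suc i # xs) i"
proof
  assume "separated (p @ Suc i # xs) i"
  then obtain k where "subseq [Suc i, k, i] (p @ Suc i # xs)"
    unfolding separated_def by auto
  then have "subseq [k, i] xs"
    using assms(1) by (subst (asm) subseq_Cons_append_Cons) auto
  then have "i \<in> set xs"
    by (auto dest: list_emb_set)
  with assms show False by auto
qed

section \<open>The course of a single pass\<close>

lemma next_value_upt:
  assumes "1 \<le> j"
  shows "next_value [1..<j] = j"
  unfolding next_value_def using assms by (intro Least_equality) auto

text \<open>
  The pass began with next value \<open>m\<close> and input \<open>l\<close>; it has read the prefix \<open>p\<close>, and the next value is
  now \<open>j\<close>. The guard \<open>m < j\<close> in the last conjunct is there because \<open>(m, m - 1)\<close> may be a separated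
  pair of the original permutation but does not hold up \<open>m\<close> once \<open>m - 1\<close> has left the input.
\<close>

definition pass_inv :: "nat \<Rightarrow> nat list \<Rightarrow> nat list \<Rightarrow> nat \<Rightarrow> nat list \<Rightarrow> bool" where
  "pass_inv m l p j st \<longleftrightarrow>
     m \<le> j \<and> {m..<j} \<subseteq> set p \<and> st = rev (filter (\<lambda>x. j \<le> x) p) \<and>
     (\<forall>i. m \<le> i \<longrightarrow> i + 1 < j \<longrightarrow> \<not> separated l i) \<and>
     (j \<in> set p \<longrightarrow> (hd st = j \<longleftrightarrow> (m < j \<longrightarrow> \<not> separated l (j - 1))))"

text \<open>Since \<open>j\<close> is on top, the old invariant rules out that \<open>j - 1\<close>
  is separated if \<open>m < j\<close>, which extends the range of non-separated indices by one.
  Whether \<open>Suc j\<close>, if already read, becomes the new top is decided by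
  \<open>separated_iff_last\<close>.\<close>

lemma pass_inv_pop:
  assumes "distinct (p @ xs)" and inv: "pass_inv m (p @ xs) p j (j # st)"
  shows "pass_inv m (p @ xs) p (Suc j) st"
proof -
  from inv have mj: "m \<le> j" and sub: "{m..<j} \<subseteq> set p"
    and stack: "j # st = rev (filter (\<lambda>x. j \<le> x) p)"
    and below: "\<And>i. m \<le> i \<Longrightarrow> i + 1 < j \<Longrightarrow> \<not> separated (p @ xs) i"
    and top: "j \<in> set p \<Longrightarrow> m < j \<Longrightarrow> \<not> separated (p @ xs) (j - 1)"
    unfolding pass_inv_def by auto
  have f: "filter (\<lambda>x. j \<le> x) p = rev st @ [j]"
    using arg_cong[OF stack, of rev] by simp
  then have jp: "j \<in> set p"
    by (metis filter_is_subset in_set_conv_decomp subsetD)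
  have "distinct (rev st @ [j])"
    using assms(1) f by (metis distinct_append distinct_filter)
  then have "j \<notin> set st" by simp
  moreover have "j \<le> x" if "x \<in> set st" for x
    using that arg_cong[OF f, of set] by auto
  ultimately have gt: "Suc j \<le> x" if "x \<in> set st" for x
    using that by (metis Suc_leI order_le_less)
  have "filter (\<lambda>x. Suc j \<le> x) p = filter (\<lambda>x. Suc j \<le> x) (filter (\<lambda>x. j \<le> x) p)"
    by (auto intro: filter_cong)
  also have "\<dots> = rev st"
    unfolding f using gt by (auto simp: filter_id_conv)
  finally have f': "filter (\<lambda>x. Suc j \<le> x) p = rev st" .
  have "hd st = Suc j \<longleftrightarrow> \<not> separated (p @ xs) j" if "Suc j \<in> set p"
  proof -
    have "Suc j \<in> set (rev st)"
      unfolding f'[symmetric] using that by simp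
    moreover from this have "last (rev st) = hd st"
      by (cases st) auto
    ultimately show ?thesis
      using separated_iff_last[OF assms(1), of j "rev st" "filter (\<lambda>x. j \<le> x) xs"] f by simp
  qed
  moreover have "\<not> separated (p @ xs) i" if "m \<le> i" "i + 1 < Suc j" for i
    using that below[of i] top[OF jp] by (cases "i + 1 = j") auto
  ultimately show ?thesis
    unfolding pass_inv_def using mj sub jp f' by (auto simp: less_Suc_eq)
qed

text \<open>The closing disjunction records that no pop is pending, which the next push relies
  on.\<close>

lemma pop_all_inv:
  assumes "distinct (p @ xs)" and "1 \<le> m" and "pass_inv m (p @ xs) p j st"
  shows "\<exists>j' st'. pop_all [1..<j] st = ([1..<j'], st') \<and> pass_inv m (p @ xs) p j' st' \<and>
           (st' = [] \<or> hd st' \<noteq> j')"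
  using assms(3)
proof (induction st arbitrary: j)
  case (Cons x st)
  have "1 \<le> j"
    using Cons.prems assms(2) by (auto simp: pass_inv_def)
  then have nv: "next_value [1..<j] = j" and upt: "[1..<j] @ [j] = [1..<Suc j]"
    by (simp_all only: next_value_upt upt_Suc_append)
  show ?case
  proof (cases "x = j")
    case True
    have "pass_inv m (p @ xs) p (Suc j) st"
      using Cons.prems assms(1) True by (intro pass_inv_pop) auto
    from Cons.IH[OF this] show ?thesis
      using True nv upt by simp
  next
    case False
    then show ?thesis
      using Cons.prems nv by auto
  qed
qed auto

text \<open>If \<open>x = j\<close>, then \<open>j\<close> is on top, and a \<open>j - 1\<close>
  output in this pass was read earlier, so the two stand in the wrong order to be separated.
  Otherwise a \<open>j\<close> already read is buried both before and after the push, because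
  \<open>top\<close> excludes a pending pop.\<close>

lemma pass_inv_push:
  assumes "distinct (p @ x # xs)" and "m \<le> x" and "pass_inv m (p @ x # xs) p j st"
    and top: "st = [] \<or> hd st \<noteq> j"
  shows "pass_inv m (p @ x # xs) (p @ [x]) j (x # st)"
proof -
  note inv = assms(3)[unfolded pass_inv_def]
  have "x \<notin> {m..<j}"
    using inv assms(1) by auto
  then have "j \<le> x"
    using assms(2) by simp
  have "x = j \<longleftrightarrow> (m < j \<longrightarrow> \<not> separated (p @ x # xs) (j - 1))" if "j \<in> set (p @ [x])"
  proof (cases "x = j")
    case True
    have "\<not> separated (p @ x # xs) (j - 1)" if "m < j"
    proof -
      have "j - 1 \<in> {m..<j}" "Suc (j - 1) = x"
        using that True by auto
      then show ?thesis
        using inv assms(1) not_separated_later[of p "j - 1" xs] by auto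
    qed
    with True show ?thesis by simp
  next
    case False
    with that have "j \<in> set p" by simp
    then have "st \<noteq> []"
      using inv by (auto simp: filter_empty_conv)
    with top False \<open>j \<in> set p\<close> show ?thesis
      using inv by auto
  qed
  then show ?thesis
    unfolding pass_inv_def using inv \<open>j \<le> x\<close> by auto
qed

lemma run_pass_inv:
  assumes "distinct (p @ xs)" and "\<forall>x \<in> set xs. m \<le> x" and "1 \<le> m"
    and "pass_inv m (p @ xs) p j st" and "st = [] \<or> hd st \<noteq> j"
  shows "\<exists>j' st'. run_pass [1..<j] st xs = ([1..<j'], st') \<and>
           pass_inv m (p @ xs) (p @ xs) j' st' \<and> (st' = [] \<or> hd st' \<noteq> j')"
  using assms
proof (induction xs arbitrary: p j st)
  case (Cons x xs)
  have "pass_inv m (p @ x # xs) (p @ [x]) j (x # st)"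
    using Cons.prems by (intro pass_inv_push) auto
  then obtain j' st' where pop: "pop_all [1..<j] (x # st) = ([1..<j'], st')"
    and inv: "pass_inv m (p @ x # xs) (p @ [x]) j' st'" "st' = [] \<or> hd st' \<noteq> j'"
    using pop_all_inv[of "p @ [x]" xs m j "x # st"] Cons.prems by auto
  have "\<exists>j'' st''. run_pass [1..<j'] st' xs = ([1..<j''], st'') \<and>
          pass_inv m ((p @ [x]) @ xs) ((p @ [x]) @ xs) j'' st'' \<and> (st'' = [] \<or> hd st'' \<noteq> j'')"
    by (rule Cons.IH) (use Cons.prems inv in auto)
  then show ?case
    using pop by simp
qed auto

text \<open>At the end of the pass all of \<open>l\<close> has been read, so a value
  \<open>j \<le> n\<close> still due lies on the stack but not on top. The last conjunct of the
  invariant then yields \<open>m < j\<close> and that \<open>j - 1\<close> is separated.\<close>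

lemma sort_pass_first_separated:
  assumes "distinct l" and l: "set l = {m..n}" and "1 \<le> m" and "m \<le> n + 1"
  shows "\<exists>j. m \<le> j \<and> j \<le> n + 1 \<and> sort_pass ([1..<m], l) = ([1..<j], filter (\<lambda>x. j \<le> x) l) \<and>
           (\<forall>i. m \<le> i \<longrightarrow> i + 1 < j \<longrightarrow> \<not> separated l i) \<and>
           (j \<le> n \<longrightarrow> m < j \<and> separated l (j - 1))"
proof -
  have "pass_inv m l [] m []"
    by (simp add: pass_inv_def)
  then obtain j st where run: "run_pass [1..<m] [] l = ([1..<j], st)"
    and inv: "pass_inv m l l j st" and top: "st = [] \<or> hd st \<noteq> j"
    using run_pass_inv[of "[]" l m m "[]"] assms by auto
  note inv = inv[unfolded pass_inv_def]
  have "j \<le> n + 1"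
  proof (rule ccontr)
    assume "\<not> j \<le> n + 1"
    then have "n + 1 \<in> {m..<j}"
      using assms(4) by simp
    with inv l show False by auto
  qed
  moreover have "m < j \<and> separated l (j - 1)" if "j \<le> n"
  proof -
    have "j \<in> set l"
      using that inv l by auto
    moreover from this have "st \<noteq> []"
      using inv by (auto simp: filter_empty_conv)
    ultimately show ?thesis
      using inv top by auto
  qed
  ultimately show ?thesis
    using run inv by (intro exI[of _ j]) (auto simp: sort_pass_def)
qed

section \<open>Counting the passes\<close>

definition passes_left :: "nat \<Rightarrow> nat list \<Rightarrow> nat \<Rightarrow> nat" where
  "passes_left n \<pi> m =
     card {i. m \<le> i \<and> i < n \<and> separated \<pi> i} + (if m \<le> n then 1 else 0)"

text \<open>Induction on \<open>k\<close>, splitting off the first pass. An inequality appears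
  because passes on an empty input change nothing. The second summand of \<open>passes_left\<close>
  stands for the final pass, needed as long as a value is left.\<close>

lemma sort_pass_iterate:
  assumes "distinct \<pi>" and \<pi>: "set \<pi> = {1..n}" and "1 \<le> m" and "m \<le> n + 1"
  shows "(sort_pass ^^ k) ([1..<m], filter (\<lambda>x. m \<le> x) \<pi>) = ([1..<Suc n], []) \<longleftrightarrow>
           passes_left n \<pi> m \<le> k"
  using assms(3,4)
proof (induction k arbitrary: m)
  case 0
  show ?case
  proof (cases "m \<le> n")
    case True
    then have "n \<in> set (filter (\<lambda>x. m \<le> x) \<pi>)"
      using 0 \<pi> by auto
    then have "filter (\<lambda>x. m \<le> x) \<pi> \<noteq> []"
      by (metis empty_iff empty_set)
    then show ?thesis
      using True by (simp add: passes_left_def)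
  next
    case False
    with 0 have "m = Suc n" by simp
    then show ?thesis
      using \<pi> by (auto simp: passes_left_def filter_empty_conv)
  qed
next
  case (Suc k)
  let ?l = "filter (\<lambda>x. m \<le> x) \<pi>"
  have "set ?l = {m..n}"
    using \<pi> Suc.prems by auto
  then obtain j where j: "m \<le> j" "j \<le> n + 1"
    and pass: "sort_pass ([1..<m], ?l) = ([1..<j], filter (\<lambda>x. j \<le> x) ?l)"
    and below: "\<And>i. m \<le> i \<Longrightarrow> i + 1 < j \<Longrightarrow> \<not> separated \<pi> i"
    and sep: "j \<le> n \<Longrightarrow> m < j \<and> separated ?l (j - 1)"
    using sort_pass_first_separated[of ?l m n] assms(1) Suc.prems
    by (auto simp: separated_filter)
  have "filter (\<lambda>x. j \<le> x) ?l = filter (\<lambda>x. j \<le> x) \<pi>"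
    using j(1) by (auto intro!: filter_cong)
  then have "(sort_pass ^^ Suc k) ([1..<m], ?l) =
      (sort_pass ^^ k) ([1..<j], filter (\<lambda>x. j \<le> x) \<pi>)"
    using pass by (simp add: funpow_Suc_right del: funpow.simps)
  also have "\<dots> = ([1..<Suc n], []) \<longleftrightarrow> passes_left n \<pi> j \<le> k"
    using Suc.IH[of j] Suc.prems j by simp
  also have "\<dots> \<longleftrightarrow> passes_left n \<pi> m \<le> Suc k"
  proof (cases "j \<le> n")
    case True
    with sep have mj: "m < j" and "separated \<pi> (j - 1)"
      using separated_filter[of m "j - 1" \<pi>] by auto
    \<comment> \<open>So \<open>j - 1\<close> is the least separated index from \<open>m\<close> on,
      and the pass removes exactly this one from the count.\<close>
    moreover have ge: "j - 1 \<le> i" if "m \<le> i" "separated \<pi> i" for i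
      using below[of i] that by (cases "i + 1 < j") auto
    ultimately have "{i. m \<le> i \<and> i < n \<and> separated \<pi> i} =
        insert (j - 1) {i. j \<le> i \<and> i < n \<and> separated \<pi> i}"
      using True mj by (force dest: ge)
    moreover have "j - 1 \<notin> {i. j \<le> i \<and> i < n \<and> separated \<pi> i}"
      using mj by auto
    ultimately show ?thesis
      using True mj by (simp add: passes_left_def)
  next
    \<comment> \<open>This pass outputs everything: \<open>passes_left\<close> is \<open>0\<close>
      at \<open>j\<close> and at most \<open>1\<close> at \<open>m\<close>, so both inequalities
      hold for every \<open>k\<close>.\<close>
    case False
    with j have "j = n + 1" by simp
    then have m0: "{i. m \<le> i \<and> i < n \<and> separated \<pi> i} = {}"
      using below by auto
    have "{i. j \<le> i \<and> i < n \<and> separated \<pi> i} = {}"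
      using False by auto
    with m0 False show ?thesis
      by (simp only: passes_left_def card.empty) simp
  qed
  finally show ?case .
qed

theorem theorem2p4:
  fixes n :: nat and \<pi> :: "nat list"
  assumes "\<pi> \<in> permutations_of_set {1..n}"
  shows "tier \<pi> = card (separated_pairs \<pi>)"
proof -
  have d: "distinct \<pi>" and s: "set \<pi> = {1..n}"
    using assms by (auto simp: permutations_of_set_def)
  have len: "length \<pi> = n"
    using distinct_card[OF d] s by simp
  let ?A = "{i. 1 \<le> i \<and> i < n \<and> separated \<pi> i}"
  have "separated_pairs \<pi> = (\<lambda>i. (i + 1, i)) ` ?A"
    unfolding separated_pairs_def separated_def len by auto
  then have card: "card (separated_pairs \<pi>) = card ?A"
    by (simp add: card_image inj_on_def)
  have "filter (\<lambda>x. 1 \<le> x) \<pi> = \<pi>"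
    using s by (simp add: filter_id_conv)
  then have "k_pass_sortable k \<pi> \<longleftrightarrow> (\<exists>j. 1 \<le> j \<and> j \<le> k \<and> passes_left n \<pi> 1 \<le> j)" for k
    using sort_pass_iterate[OF d s, of 1] unfolding k_pass_sortable_def len by simp
  \<comment> \<open>The maximum reflects the mandatory first pass; it matters only for
    \<open>n = 0\<close>, where \<open>passes_left\<close> is \<open>0\<close>.\<close>
  then have "k_pass_sortable k \<pi> \<longleftrightarrow> max 1 (passes_left n \<pi> 1) \<le> k" for k
    by auto
  then have "tier \<pi> = max 1 (passes_left n \<pi> 1) - 1"
    unfolding tier_def by (metis (no_types, lifting) Least_equality order_refl)
  also have "\<dots> = card ?A"
    by (auto simp: passes_left_def)
  finally show ?thesis
    using card by simp
qed

end
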